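(* Let $q\geq 2$, $s,t\in\mathbb{Z}_q$ and $g:\mathbb{Z}_q\to\mathbb{C}$. Let $G=(V,E)$ be a finite graph with a fixed orientation $\overrightarrow{E}$, and define $$F^{(q)}(G;\mathbf{x})=\prod_{(u,v)\in\overrightarrow{E}}\;\sum_{b\in\mathbb{Z}_q}g(b)\,x_u^{t-sb}x_v^{b}\ \bmod (x_v^q-1:v\in V).$$ Let $S,T:\mathbb{Z}_q^V\to\mathbb{Z}_q^E$ be the linear maps $(S\mathbf{d})_e=d_v-sd_u$ and $(T\mathbf{d})_e=td_u$ for $e=(u,v)\in\overrightarrow{E}$, with transposes $S^\top,T^\top:\mathbb{Z}_q^E\to\mathbb{Z}_q^V$, and let $\mathbf{1}\in\mathbb{Z}_q^V$ be the all-one vector. If $\mathbf{a}\in\mathbb{Z}_q^V$ and $\mathbf{b}\in\mathbb{Z}_q^E$ satisfy $S^\top\mathbf{b}=\mathbf{a}-T^\top\mathbf{1}$, then $$[\mathbf{x}^{\mathbf{a}}]F^{(q)}(G;\mathbf{x})=\sum_{\mathbf{b}'\in\ker(S^\top)+\mathbf{b}}\ \prod_{e\in E}g(b'_e),$$ a complete coset weight enumerator of $\ker(S^\top)$. In particular the coefficient $[\mathbf{x}^{T^\top\mathbf{1}}]F^{(q)}(G;\mathbf{x})=\sum_{\mathbf{b}'\in\ker(S^\top)}\prod_{e\in E}g(b'_e)$ is an evaluation of the complete weight enumerator of $\ker(S^\top)$ (and of $\mathrm{im}(S)$).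
   Context: Exponents are read modulo $q$; $\mathbb{C}[\mathbf{x}]/(x_v^q-1:v\in V)$ has monomial basis $\mathbf{x}^{\mathbf{a}}=\prod_{v}x_v^{a_v}$, $\mathbf{a}\in\mathbb{Z}_q^V$ (exponents in $\{0,\ldots,q-1\}$), and $[\mathbf{x}^{\mathbf{a}}]$ denotes the coefficient of $\mathbf{x}^{\mathbf{a}}$. Explicitly $(S^\top\mathbf{b})_v=\sum_{e=(u,v)\in\overrightarrow{E}}b_e-s\sum_{e=(v,u)\in\overrightarrow{E}}b_e$ and $(T^\top\mathbf{b})_v=t\sum_{e=(v,u)\in\overrightarrow{E}}b_e$. The complete weight enumerator of a subset $\mathbf{P}\subseteq\mathbb{Z}_q^E$ is $\sum_{\mathbf{p}\in\mathbf{P}}\prod_{a\in\mathbb{Z}_q}x_a^{\#\{e:p_e=a\}}$; an evaluation of it means substituting complex values for the $x_a$ (here $x_a=g(a)$).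
   Formalization: The English places the all-one vector 1 in Z_q^V, but T^⊤ acts on Z_q^E, so T^⊤1 is undefined as written; the formal statement takes 1 to be the all-one vector in Z_q^E. *)

theory Defs
  imports
    Complex_Main
    "HOL-Library.FuncSet"
    "HOL-Library.Poly_Mapping"
    "Berlekamp_Zassenhaus.Finite_Field"
    "Graph_Theory.Digraph"
begin

text \<open>
  Conventions. The ring of integers modulo \<open>q\<close> is \<^typ>\<open>'q mod_ring\<close> with \<open>q = CARD('q)\<close>; the class
  \<^class>\<open>nontriv\<close> says exactly \<open>q \<ge> 2\<close>, and every \<open>q \<ge> 2\<close> is the cardinality of such a type.
  A finite graph together with an orientation is a \<^locale>\<open>fin_digraph\<close>: the edges are \<open>arcs G\<close>, and the
  edge \<open>e = (u, v)\<close> has \<open>u = tail G e\<close> and \<open>v = head G e\<close>. Loops and parallel edges are allowed.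
\<close>

type_synonym ('x, 'c) mpoly = "('x \<Rightarrow>\<^sub>0 nat) \<Rightarrow>\<^sub>0 'c"

definition Var :: "'x \<Rightarrow> ('x, 'c::comm_semiring_1) mpoly" where
  "Var x = Poly_Mapping.single (Poly_Mapping.single x 1) 1"

definition Const :: "'c::comm_semiring_1 \<Rightarrow> ('x, 'c) mpoly" where
  "Const c = Poly_Mapping.single 0 c"

definition mpoly_eval :: "('x \<Rightarrow> 'c::comm_semiring_1) \<Rightarrow> ('x, 'c) mpoly \<Rightarrow> 'c" where
  "mpoly_eval y p = (\<Sum>m\<in>Poly_Mapping.keys p. Poly_Mapping.lookup p m * (\<Prod>x\<in>Poly_Mapping.keys m. y x ^ Poly_Mapping.lookup m x))"

text \<open>The polynomial ring in the variables from \<open>V\<close>, as a subring of all polynomials over the type \<open>'x\<close>.\<close>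

definition polys :: "'x set \<Rightarrow> ('x, 'c::comm_ring_1) mpoly set" where
  "polys V = {p. \<forall>m\<in>Poly_Mapping.keys p. Poly_Mapping.keys m \<subseteq> V}"

text \<open>For finite \<open>V\<close>: the ideal of \<open>polys V\<close> generated by the polynomials \<open>x\<^sub>v ^ q - 1\<close> with \<open>v \<in> V\<close>.\<close>

definition cyclic_ideal :: "nat \<Rightarrow> 'x set \<Rightarrow> ('x, 'c::comm_ring_1) mpoly set" where
  "cyclic_ideal q V = {\<Sum>v\<in>V. h v * (Var v ^ q - 1) | h. \<forall>v\<in>V. h v \<in> polys V}"

definition reduced_polys :: "nat \<Rightarrow> 'x set \<Rightarrow> ('x, 'c::comm_ring_1) mpoly set" where
  "reduced_polys q V = {r \<in> polys V. \<forall>m\<in>Poly_Mapping.keys r. \<forall>v\<in>V. Poly_Mapping.lookup m v < q}"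

text \<open>
  For finite \<open>V\<close> and \<open>q \<ge> 1\<close>, every residue class of \<open>polys V\<close> modulo \<open>cyclic_ideal q V\<close> contains
  exactly one polynomial with all exponents in \<open>{0..<q}\<close>; its coefficients are the coordinates of the
  class in the monomial basis of the quotient ring.
\<close>

definition poly_mod :: "nat \<Rightarrow> 'x set \<Rightarrow> ('x, 'c::comm_ring_1) mpoly \<Rightarrow> ('x, 'c) mpoly" where
  "poly_mod q V p = (THE r. r \<in> reduced_polys q V \<and> p - r \<in> cyclic_ideal q V)"

definition rep :: "'q::nontriv mod_ring \<Rightarrow> nat" where
  "rep a = nat (to_int_mod_ring a)"

definition coeff_at :: "'x set \<Rightarrow> ('x \<Rightarrow> 'q::nontriv mod_ring) \<Rightarrow> ('x, 'c::zero) mpoly \<Rightarrow> 'c" where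
  "coeff_at V a p = Poly_Mapping.lookup p (\<Sum>v\<in>V. Poly_Mapping.single v (rep (a v)))"

definition graph_poly ::
  "('v, 'e) pre_digraph \<Rightarrow> 'q::nontriv mod_ring \<Rightarrow> 'q mod_ring \<Rightarrow> ('q mod_ring \<Rightarrow> complex)
    \<Rightarrow> ('v, complex) mpoly" where
  "graph_poly G s t g = poly_mod CARD('q) (verts G)
     (\<Prod>e\<in>arcs G. \<Sum>b\<in>UNIV.
        Const (g b) * Var (tail G e) ^ rep (t - s * b) * Var (head G e) ^ rep b)"

text \<open>
  Vectors indexed by \<open>I\<close> are extensional functions (\<open>undefined\<close> outside \<open>I\<close>), so that the sets of
  vectors below have the correct cardinalities and sums over them count each vector once.
\<close>

definition vecs :: "'i set \<Rightarrow> ('i \<Rightarrow> 'q::nontriv mod_ring) set" where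
  "vecs I = (\<Pi>\<^sub>E i\<in>I. UNIV)"

definition S_map :: "('v, 'e) pre_digraph \<Rightarrow> 'q::nontriv mod_ring \<Rightarrow>
    ('v \<Rightarrow> 'q mod_ring) \<Rightarrow> 'e \<Rightarrow> 'q mod_ring" where
  "S_map G s d = (\<lambda>e\<in>arcs G. d (head G e) - s * d (tail G e))"

definition T_map :: "('v, 'e) pre_digraph \<Rightarrow> 'q::nontriv mod_ring \<Rightarrow>
    ('v \<Rightarrow> 'q mod_ring) \<Rightarrow> 'e \<Rightarrow> 'q mod_ring" where
  "T_map G t d = (\<lambda>e\<in>arcs G. t * d (tail G e))"

definition S_tr :: "('v, 'e) pre_digraph \<Rightarrow> 'q::nontriv mod_ring \<Rightarrow>
    ('e \<Rightarrow> 'q mod_ring) \<Rightarrow> 'v \<Rightarrow> 'q mod_ring" where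
  "S_tr G s b = (\<lambda>v\<in>verts G. (\<Sum>e\<in>{e \<in> arcs G. head G e = v}. b e)
                            - s * (\<Sum>e\<in>{e \<in> arcs G. tail G e = v}. b e))"

definition T_tr :: "('v, 'e) pre_digraph \<Rightarrow> 'q::nontriv mod_ring \<Rightarrow>
    ('e \<Rightarrow> 'q mod_ring) \<Rightarrow> 'v \<Rightarrow> 'q mod_ring" where
  "T_tr G t b = (\<lambda>v\<in>verts G. t * (\<Sum>e\<in>{e \<in> arcs G. tail G e = v}. b e))"

lemma sum_fibres:
  fixes d b :: "_ \<Rightarrow> 'q::nontriv mod_ring"
  assumes "finite E" "finite V" "f ` E \<subseteq> V"
  shows "(\<Sum>v\<in>V. d v * (\<Sum>e\<in>{e \<in> E. f e = v}. b e)) = (\<Sum>e\<in>E. d (f e) * b e)"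
proof -
  have "(\<Sum>v\<in>V. d v * (\<Sum>e\<in>{e \<in> E. f e = v}. b e))
      = (\<Sum>v\<in>V. \<Sum>e\<in>{e \<in> E. f e = v}. d (f e) * b e)"
    by (simp add: sum_distrib_left)
  also have "\<dots> = (\<Sum>e\<in>E. d (f e) * b e)"
    using assms by (rule sum.group)
  finally show ?thesis .
qed

lemma S_tr_adjoint:
  assumes "fin_digraph G"
  shows "(\<Sum>e\<in>arcs G. S_map G s d e * b e) = (\<Sum>v\<in>verts G. d v * S_tr G s b v)"
proof -
  interpret fin_digraph G by fact
  have h: "(\<Sum>v\<in>verts G. d v * (\<Sum>e\<in>{e \<in> arcs G. head G e = v}. b e))
      = (\<Sum>e\<in>arcs G. d (head G e) * b e)"
    by (rule sum_fibres) auto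
  have t: "(\<Sum>v\<in>verts G. d v * (\<Sum>e\<in>{e \<in> arcs G. tail G e = v}. b e))
      = (\<Sum>e\<in>arcs G. d (tail G e) * b e)"
    by (rule sum_fibres) auto
  have "(\<Sum>v\<in>verts G. d v * S_tr G s b v)
      = (\<Sum>v\<in>verts G. d v * (\<Sum>e\<in>{e \<in> arcs G. head G e = v}. b e))
        - s * (\<Sum>v\<in>verts G. d v * (\<Sum>e\<in>{e \<in> arcs G. tail G e = v}. b e))"
    unfolding sum_distrib_left[of s "\<lambda>v. d v * _ v"]
    by (simp add: S_tr_def right_diff_distrib sum_subtractf mult.left_commute)
  also have "\<dots> = (\<Sum>e\<in>arcs G. S_map G s d e * b e)"
    unfolding h t
    by (simp add: S_map_def left_diff_distrib sum_subtractf sum_distrib_left mult.assoc)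
  finally show ?thesis ..
qed

lemma T_tr_adjoint:
  assumes "fin_digraph G"
  shows "(\<Sum>e\<in>arcs G. T_map G t d e * b e) = (\<Sum>v\<in>verts G. d v * T_tr G t b v)"
proof -
  interpret fin_digraph G by fact
  have "(\<Sum>v\<in>verts G. d v * T_tr G t b v)
      = t * (\<Sum>v\<in>verts G. d v * (\<Sum>e\<in>{e \<in> arcs G. tail G e = v}. b e))"
    unfolding sum_distrib_left[of t "\<lambda>v. d v * _ v"]
    by (simp add: T_tr_def mult.left_commute)
  also have "(\<Sum>v\<in>verts G. d v * (\<Sum>e\<in>{e \<in> arcs G. tail G e = v}. b e))
      = (\<Sum>e\<in>arcs G. d (tail G e) * b e)"
    by (rule sum_fibres) auto
  finally show ?thesis
    by (simp add: T_map_def sum_distrib_left mult.assoc)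
qed

definition ker_S_tr :: "('v, 'e) pre_digraph \<Rightarrow> 'q::nontriv mod_ring \<Rightarrow> ('e \<Rightarrow> 'q mod_ring) set" where
  "ker_S_tr G s = {b \<in> vecs (arcs G). S_tr G s b = (\<lambda>v\<in>verts G. 0)}"

definition im_S :: "('v, 'e) pre_digraph \<Rightarrow> 'q::nontriv mod_ring \<Rightarrow> ('e \<Rightarrow> 'q mod_ring) set" where
  "im_S G s = S_map G s ` vecs (verts G)"

definition translate :: "'i set \<Rightarrow> ('i \<Rightarrow> 'q::nontriv mod_ring) set \<Rightarrow> ('i \<Rightarrow> 'q mod_ring)
    \<Rightarrow> ('i \<Rightarrow> 'q mod_ring) set" where
  "translate I K b = (\<lambda>k. \<lambda>i\<in>I. k i + b i) ` K"

definition cwe :: "'e set \<Rightarrow> ('e \<Rightarrow> 'q::nontriv mod_ring) set \<Rightarrow> ('q mod_ring, complex) mpoly" where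
  "cwe E P = (\<Sum>p\<in>P. \<Prod>a\<in>UNIV. Var a ^ card {e \<in> E. p e = a})"

text \<open>
  MacWilliams transform: the kernel of \<open>S_tr\<close> is the dual of the image of \<open>S_map\<close>, so sums of products of
  \<open>g\<close> over the former are, up to division by the size of the latter, sums of products of \<open>fourier g\<close>
  over the latter. As \<open>cwe E P\<close> is homogeneous of degree \<open>card E\<close>, that scalar can be absorbed into the
  substituted values.
\<close>

definition fourier :: "('q::nontriv mod_ring \<Rightarrow> complex) \<Rightarrow> 'q mod_ring \<Rightarrow> complex" where
  "fourier g a = (\<Sum>b\<in>UNIV. g b * cis (2 * pi * real (rep a * rep b) / real CARD('q)))"

end

theory Submission
  imports Defs "HOL-Library.Real_Mod"
begin

text \<open>
  Choosing one summand per edge, i.e. a vector \<open>b\<close>, produces in the product the monomial whose exponent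
  at \<open>v\<close> is congruent to \<open>(T\<^sup>\<top> 1 + S\<^sup>\<top> b)\<^sub>v\<close>; hence the coefficient at \<open>a\<close> sums over the solutions of
  \<open>S\<^sup>\<top> b = a - T\<^sup>\<top> 1\<close>, which form a coset of the kernel. Since \<open>ker S\<^sup>\<top>\<close> is the orthogonal complement of
  \<open>im S\<close>, orthogonality of additive characters on \<open>im S\<close> turns the kernel sum into a sum over \<open>im S\<close>
  with the transformed weights; the factor \<open>1 / card (im S)\<close> is spread evenly over the \<open>card E\<close> weights.
\<close>

section \<open>Linear functionals on polynomials\<close>

text \<open>Common form of \<open>mpoly_eval\<close> and \<open>residue_coeff\<close>: a linear
  functional is fixed by its values \<open>w\<close> on monomials, so linearity is proved once for
  both.\<close>

definition linear_extension :: "(('x \<Rightarrow>\<^sub>0 nat) \<Rightarrow> 'c) \<Rightarrow> ('x, 'c::comm_semiring_1) mpoly \<Rightarrow> 'c" where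
  "linear_extension w p = (\<Sum>m\<in>Poly_Mapping.keys p. Poly_Mapping.lookup p m * w m)"

text \<open>Cancellation can make the keys of a sum smaller than the union of the keys. Padding with
  zero coefficients lets several polynomials be summed over one index set.\<close>

lemma linear_extension_superset:
  assumes "finite M" "Poly_Mapping.keys p \<subseteq> M"
  shows "linear_extension w p = (\<Sum>m\<in>M. Poly_Mapping.lookup p m * w m)"
  unfolding linear_extension_def using assms
  by (intro sum.mono_neutral_left) (auto simp: in_keys_iff)

lemma linear_extension_0 [simp]: "linear_extension w 0 = 0"
  by (simp add: linear_extension_def)

lemma linear_extension_add:
  "linear_extension w (p + q) = linear_extension w p + linear_extension w q"
proof -
  let ?M = "Poly_Mapping.keys p \<union> Poly_Mapping.keys q"
  have "linear_extension w r = (\<Sum>m\<in>?M. Poly_Mapping.lookup r m * w m)" if "r \<in> {p, q, p + q}" for r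
    using that keys_add[of p q] by (intro linear_extension_superset) auto
  then show ?thesis
    by (simp add: lookup_add distrib_right sum.distrib)
qed

lemma linear_extension_diff:
  fixes p q :: "('x, 'c::comm_ring_1) mpoly"
  shows "linear_extension w (p - q) = linear_extension w p - linear_extension w q"
  using linear_extension_add[of w "p - q" q] by simp

lemma linear_extension_sum:
  "linear_extension w (\<Sum>i\<in>I. p i) = (\<Sum>i\<in>I. linear_extension w (p i))"
  by (induction I rule: infinite_finite_induct) (auto simp: linear_extension_add)

lemma linear_extension_single [simp]:
  "linear_extension w (Poly_Mapping.single m c) = c * w m"
  by (simp add: linear_extension_def)

lemma mpoly_eval_eq_linear_extension:
  "mpoly_eval y = linear_extension
     (\<lambda>m. \<Prod>x\<in>Poly_Mapping.keys m. y x ^ Poly_Mapping.lookup m x)"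
  by (simp add: fun_eq_iff mpoly_eval_def linear_extension_def)

lemma sum_monomials:
  "(\<Sum>m\<in>Poly_Mapping.keys p. Poly_Mapping.single m (Poly_Mapping.lookup p m)) = p"
  by (rule poly_mapping_eqI)
     (auto simp: lookup_sum lookup_single when_def in_keys_iff sum.delta')

text \<open>Multiplication by a monomial shifts all exponents, which can be moved into the weight. A
  weight that depends only on residues modulo \<open>q\<close> will not notice the factor
  \<open>Var v ^ q\<close>.\<close>

lemma linear_extension_mult_monomial:
  "linear_extension w (h * Poly_Mapping.single k 1) = linear_extension (\<lambda>m. w (m + k)) h"
proof -
  have "h * Poly_Mapping.single k 1
      = (\<Sum>m\<in>Poly_Mapping.keys h. Poly_Mapping.single (m + k) (Poly_Mapping.lookup h m))"
    by (subst (1) sum_monomials[of h, symmetric]) (simp add: sum_distrib_right mult_single)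
  then show ?thesis
    by (simp add: linear_extension_sum) (simp add: linear_extension_def)
qed

lemma Var_power: "Var x ^ n = Poly_Mapping.single (Poly_Mapping.single x n) 1"
proof (induction n)
  case (Suc n)
  then show ?case by (simp add: Var_def mult_single flip: single_add)
qed simp

lemma prod_monomials:
  "(\<Prod>i\<in>I. Poly_Mapping.single (m i) (c i)) = Poly_Mapping.single (\<Sum>i\<in>I. m i) (\<Prod>i\<in>I. c i)"
  for m :: "'i \<Rightarrow> 'x \<Rightarrow>\<^sub>0 nat"
  by (induction I rule: infinite_finite_induct) (simp_all add: mult_single)

section \<open>The normal form modulo \<open>x\<^sub>v ^ q - 1\<close>\<close>

lemma polys_sum: "(\<And>i. i \<in> I \<Longrightarrow> p i \<in> polys V) \<Longrightarrow> (\<Sum>i\<in>I. p i) \<in> polys V"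
  using keys_sum[of p I] unfolding polys_def by blast

lemma polys_single: "Poly_Mapping.keys m \<subseteq> V \<Longrightarrow> Poly_Mapping.single m c \<in> polys V"
  by (simp add: polys_def)

lemma polys_add: "p \<in> polys V \<Longrightarrow> r \<in> polys V \<Longrightarrow> p + r \<in> polys V"
  using keys_add[of p r] unfolding polys_def by blast

lemma cyclic_ideal_add:
  assumes "p \<in> cyclic_ideal q V" "r \<in> cyclic_ideal q V"
  shows "p + r \<in> cyclic_ideal q V"
proof -
  from assms obtain h k where hk: "\<forall>v\<in>V. h v \<in> polys V" "\<forall>v\<in>V. k v \<in> polys V"
    and "p = (\<Sum>v\<in>V. h v * (Var v ^ q - 1))" "r = (\<Sum>v\<in>V. k v * (Var v ^ q - 1))"
    unfolding cyclic_ideal_def by blast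
  then have "p + r = (\<Sum>v\<in>V. (h v + k v) * (Var v ^ q - 1))"
    by (simp add: distrib_right sum.distrib)
  moreover have "\<forall>v\<in>V. h v + k v \<in> polys V"
    using hk by (auto intro: polys_add)
  ultimately show ?thesis
    unfolding cyclic_ideal_def by (auto intro!: exI[of _ "\<lambda>v. h v + k v"])
qed

lemma zero_in_cyclic_ideal: "0 \<in> cyclic_ideal q V"
  unfolding cyclic_ideal_def by (auto intro!: exI[of _ "\<lambda>_. 0"] simp: polys_def)

lemma generator_multiple_in_cyclic_ideal:
  assumes "finite V" "v \<in> V" "h \<in> polys V"
  shows "h * (Var v ^ q - 1) \<in> cyclic_ideal q V"
proof -
  have "h * (Var v ^ q - 1) = (\<Sum>u\<in>V. (if u = v then h else 0) * (Var u ^ q - 1))"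
    using assms by (simp add: if_distrib[of "\<lambda>x. x * _"] cong: if_cong)
  moreover have "\<forall>u\<in>V. (if u = v then h else 0) \<in> polys V"
    using assms by (auto simp: polys_def)
  ultimately show ?thesis
    unfolding cyclic_ideal_def by (auto intro!: exI[of _ "\<lambda>u. if u = v then h else 0"])
qed

lemma reduced_polys_add:
  assumes "p \<in> reduced_polys q V" "r \<in> reduced_polys q V"
  shows "p + r \<in> reduced_polys q V"
  using assms keys_add[of p r] by (auto simp: reduced_polys_def polys_add)

text \<open>Replacing a factor \<open>Var v ^ q\<close> by 1 stays in the residue class and lowers
  the total degree; this is repeated until all exponents are below \<open>q\<close>.\<close>

lemma monomial_reduction:
  assumes "finite V" "q > 0" "Poly_Mapping.keys m \<subseteq> V"
  shows "\<exists>r\<in>reduced_polys q V. Poly_Mapping.single m c - r \<in> cyclic_ideal q V"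
  using assms(3)
proof (induction "\<Sum>v\<in>V. Poly_Mapping.lookup m v" arbitrary: m rule: less_induct)
  case (less m)
  show ?case
  proof (cases "\<forall>v\<in>V. Poly_Mapping.lookup m v < q")
    case True
    then have "Poly_Mapping.single m c \<in> reduced_polys q V"
      using less.prems by (auto simp: reduced_polys_def polys_single)
    then show ?thesis
      by (intro bexI[of _ "Poly_Mapping.single m c"]) (auto simp: zero_in_cyclic_ideal)
  next
    case False
    then obtain v where v: "v \<in> V" "q \<le> Poly_Mapping.lookup m v"
      by force
    define k where "k = Poly_Mapping.single v q"
    \<comment> \<open>Subtraction of exponents is truncated; it is exact here because the exponent
      of \<open>v\<close> is at least \<open>q\<close>.\<close>
    define m' where "m' = m - k"
    have m: "m = m' + k"
      using v by (intro poly_mapping_eqI)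
        (auto simp: m'_def k_def lookup_add lookup_minus lookup_single when_def)
    have "Poly_Mapping.keys m' \<subseteq> Poly_Mapping.keys m"
      by (auto simp: m'_def in_keys_iff lookup_minus)
    then have keys: "Poly_Mapping.keys m' \<subseteq> V"
      using less.prems by blast
    have "(\<Sum>u\<in>V. Poly_Mapping.lookup m' u) < (\<Sum>u\<in>V. Poly_Mapping.lookup m u)"
      using v assms(1,2)
      by (intro sum_strict_mono_ex1) (auto simp: m k_def lookup_add intro!: bexI[of _ v])
    then obtain r where r: "r \<in> reduced_polys q V"
        "Poly_Mapping.single m' c - r \<in> cyclic_ideal q V"
      using less.hyps keys by blast
    \<comment> \<open>The first summand is a multiple of the generator at \<open>v\<close>; the
      second lies in the ideal by the induction hypothesis.\<close>
    have "Poly_Mapping.single m c - r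
        = Poly_Mapping.single m' c * (Var v ^ q - 1) + (Poly_Mapping.single m' c - r)"
      by (simp add: m k_def Var_power right_diff_distrib mult_single)
    also have "\<dots> \<in> cyclic_ideal q V"
      using r v assms(1) keys
      by (intro cyclic_ideal_add generator_multiple_in_cyclic_ideal polys_single)
    finally have "Poly_Mapping.single m c - r \<in> cyclic_ideal q V" .
    with r show ?thesis by blast
  qed
qed

lemma reduction_exists:
  assumes "finite V" "q > 0" "p \<in> polys V"
  shows "\<exists>r\<in>reduced_polys q V. p - r \<in> cyclic_ideal q V"
proof -
  \<comment> \<open>The induction runs over sets of monomials with \<open>p\<close> fixed, so that
    the coefficients stay those of \<open>p\<close>.\<close>
  have "\<exists>r\<in>reduced_polys q V.
      (\<Sum>m\<in>M. Poly_Mapping.single m (Poly_Mapping.lookup p m)) - r \<in> cyclic_ideal q V"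
    if "finite M" "M \<subseteq> Poly_Mapping.keys p" for M
    using that
  proof (induction M rule: finite_induct)
    case empty
    show ?case
      by (intro bexI[of _ 0]) (auto simp: zero_in_cyclic_ideal reduced_polys_def polys_def)
  next
    case (insert m M)
    from insert obtain r where r: "r \<in> reduced_polys q V"
      "(\<Sum>m\<in>M. Poly_Mapping.single m (Poly_Mapping.lookup p m)) - r \<in> cyclic_ideal q V"
      by auto
    have "Poly_Mapping.keys m \<subseteq> V"
      using insert.prems assms(3) by (auto simp: polys_def)
    from monomial_reduction[OF assms(1,2) this] obtain r' where r': "r' \<in> reduced_polys q V"
      "Poly_Mapping.single m (Poly_Mapping.lookup p m) - r' \<in> cyclic_ideal q V"
      by blast
    show ?case
      using insert.hyps reduced_polys_add[OF r'(1) r(1)] cyclic_ideal_add[OF r'(2) r(2)]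
      by (intro bexI[of _ "r' + r"]) (simp_all add: algebra_simps)
  qed
  from this[of "Poly_Mapping.keys p"] show ?thesis
    by (simp add: sum_monomials)
qed

section \<open>Representatives modulo \<open>q\<close> and residue classes of monomials\<close>

lemma of_nat_rep [simp]: "of_nat (rep a) = a"
proof -
  have "to_int_mod_ring a \<in> range (to_int_mod_ring :: 'a mod_ring \<Rightarrow> int)" by blast
  then show ?thesis
    by (simp add: rep_def range_to_int_mod_ring of_nat_of_int_mod_ring)
qed

lemma rep_less: "rep (a :: 'q::nontriv mod_ring) < CARD('q)"
proof -
  have "to_int_mod_ring a \<in> range (to_int_mod_ring :: 'q mod_ring \<Rightarrow> int)" by blast
  then show ?thesis
    unfolding range_to_int_mod_ring by (auto simp: rep_def nat_less_iff)
qed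

lemma rep_of_nat: "rep (of_nat n :: 'q::nontriv mod_ring) = n mod CARD('q)"
proof -
  have "of_nat n = (of_nat (n mod CARD('q)) :: 'q mod_ring)"
    using of_nat_mod_CHAR[where 'a = "'q mod_ring", of n] by simp
  also have "\<dots> = of_int_mod_ring (int (n mod CARD('q)))"
    by (simp add: of_nat_of_int_mod_ring)
  finally show ?thesis
    by (simp add: rep_def del: of_nat_mod)
qed

text \<open>
  Collects the coefficients of all monomials congruent to \<open>x\<^sup>a\<close>. It vanishes on the ideal and reads off
  a coefficient of a reduced polynomial, which gives both uniqueness and the value of the normal form.
\<close>

definition residue_coeff ::
  "'x set \<Rightarrow> ('x \<Rightarrow> 'q::nontriv mod_ring) \<Rightarrow> ('x, 'c::comm_semiring_1) mpoly \<Rightarrow> 'c" where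
  "residue_coeff V a = linear_extension (\<lambda>m. of_bool (\<forall>v\<in>V. of_nat (Poly_Mapping.lookup m v) = a v))"

text \<open>The factor \<open>Var v ^ q\<close> adds \<open>q\<close>, which is 0 in the ring of
  residues, to one exponent. Hence both terms of a multiple of a generator get the same
  value.\<close>

lemma residue_coeff_cyclic_ideal:
  fixes a :: "'x \<Rightarrow> 'q::nontriv mod_ring" and p :: "('x, 'c::comm_ring_1) mpoly"
  assumes "p \<in> cyclic_ideal CARD('q) V"
  shows "residue_coeff V a p = 0"
proof -
  have "residue_coeff V a (h * (Var v ^ CARD('q) - 1)) = 0" for h :: "('x, 'c) mpoly" and v
    by (auto simp: residue_coeff_def right_diff_distrib linear_extension_diff Var_power
        linear_extension_mult_monomial lookup_add lookup_single when_def
        intro!: arg_cong[where f = "\<lambda>w. linear_extension w h"] ext)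
  with assms show ?thesis
    by (auto simp: cyclic_ideal_def residue_coeff_def linear_extension_sum)
qed

lemma lookup_sum_single:
  "finite V \<Longrightarrow> Poly_Mapping.lookup (\<Sum>v\<in>V. Poly_Mapping.single v (f v)) x = (if x \<in> V then f x else 0)"
  by (simp add: lookup_sum lookup_single when_def)

text \<open>Exponents below \<open>q\<close> are determined by their residues, so the class of
  \<open>a\<close> contains at most one monomial of \<open>r\<close>, the one inspected by
  \<open>coeff_at\<close>.\<close>

lemma residue_coeff_reduced:
  fixes a :: "'x \<Rightarrow> 'q::nontriv mod_ring"
  assumes "finite V" "r \<in> reduced_polys CARD('q) V"
  shows "residue_coeff V a r = coeff_at V a r"
proof -
  let ?n = "\<Sum>v\<in>V. Poly_Mapping.single v (rep (a v))"
  have *: "(\<forall>v\<in>V. of_nat (Poly_Mapping.lookup m v) = a v) \<longleftrightarrow> m = ?n"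
    if m: "m \<in> Poly_Mapping.keys r" for m
  proof
    assume eq: "\<forall>v\<in>V. of_nat (Poly_Mapping.lookup m v) = a v"
    show "m = ?n"
    proof (rule poly_mapping_eqI)
      fix x
      show "Poly_Mapping.lookup m x = Poly_Mapping.lookup ?n x"
      proof (cases "x \<in> V")
        case True
        then have "rep (a x) = Poly_Mapping.lookup m x mod CARD('q)"
          using eq by (metis rep_of_nat)
        with True m assms show ?thesis
          by (simp add: lookup_sum_single reduced_polys_def)
      next
        case False
        with m assms show ?thesis
          by (auto simp: lookup_sum_single reduced_polys_def polys_def in_keys_iff subset_iff)
      qed
    qed
  next
    assume "m = ?n"
    then show "\<forall>v\<in>V. of_nat (Poly_Mapping.lookup m v) = a v"
      using assms(1) by (simp add: lookup_sum_single)
  qed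
  have "residue_coeff V a r = (\<Sum>m\<in>Poly_Mapping.keys r. Poly_Mapping.lookup r m * of_bool (m = ?n))"
    unfolding residue_coeff_def linear_extension_def by (intro sum.cong refl) (simp add: *)
  also have "\<dots> = coeff_at V a r"
    by (auto simp: coeff_at_def of_bool_def in_keys_iff if_distrib[of "(*) _"] cong: if_cong)
  finally show ?thesis .
qed

text \<open>The exponents of a reduced monomial are the representatives of their own residues, so
  every coefficient is a value of some \<open>residue_coeff\<close>: these functionals separate
  reduced polynomials.\<close>

lemma reduced_polys_eqI:
  fixes r r' :: "('x, 'c::comm_ring_1) mpoly"
  assumes "finite V" "r \<in> reduced_polys CARD('q::nontriv) V" "r' \<in> reduced_polys CARD('q) V"
    and "\<And>a :: 'x \<Rightarrow> 'q mod_ring. residue_coeff V a r = residue_coeff V a r'"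
  shows "r = r'"
proof (rule poly_mapping_eqI)
  fix m
  show "Poly_Mapping.lookup r m = Poly_Mapping.lookup r' m"
  proof (cases "m \<in> Poly_Mapping.keys r \<union> Poly_Mapping.keys r'")
    case True
    then have m: "Poly_Mapping.keys m \<subseteq> V" "\<forall>v\<in>V. Poly_Mapping.lookup m v < CARD('q)"
      using assms(2,3) by (auto simp: reduced_polys_def polys_def)
    define a :: "'x \<Rightarrow> 'q mod_ring" where "a v = of_nat (Poly_Mapping.lookup m v)" for v
    have "m = (\<Sum>v\<in>V. Poly_Mapping.single v (rep (a v)))"
      using m assms(1)
      by (intro poly_mapping_eqI)
        (auto simp: lookup_sum_single a_def rep_of_nat in_keys_iff subset_iff)
    then show ?thesis
      using assms(4)[of a] residue_coeff_reduced[OF assms(1,2), of a]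
        residue_coeff_reduced[OF assms(1,3), of a]
      by (simp add: coeff_at_def)
  qed (simp add: in_keys_iff)
qed

text \<open>Since \<open>residue_coeff\<close> is constant on residue classes, it can be evaluated
  on \<open>p\<close> itself, without carrying out the reduction.\<close>

lemma coeff_at_poly_mod:
  fixes a :: "'x \<Rightarrow> 'q::nontriv mod_ring"
  assumes "finite V" "p \<in> polys V"
  shows "coeff_at V a (poly_mod CARD('q) V p) = residue_coeff V a p"
proof -
  have res: "residue_coeff V b r = residue_coeff V b p"
    if "p - r \<in> cyclic_ideal CARD('q) V" for r and b :: "'x \<Rightarrow> 'q mod_ring"
    using residue_coeff_cyclic_ideal[OF that, of b]
    by (simp add: residue_coeff_def linear_extension_diff)
  \<comment> \<open>The description operator in \<open>poly_mod\<close> needs uniqueness as well: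
    any two candidates have the residue coefficients of \<open>p\<close>.\<close>
  have "\<exists>!r. r \<in> reduced_polys CARD('q) V \<and> p - r \<in> cyclic_ideal CARD('q) V"
    using reduction_exists[OF assms(1) _ assms(2), of "CARD('q)"] res
    by (auto intro!: reduced_polys_eqI[OF assms(1)])
  from theI'[OF this] have "poly_mod CARD('q) V p \<in> reduced_polys CARD('q) V"
      "p - poly_mod CARD('q) V p \<in> cyclic_ideal CARD('q) V"
    by (auto simp: poly_mod_def)
  then show ?thesis
    using residue_coeff_reduced[OF assms(1)] res by metis
qed

section \<open>Coefficients of the graph polynomial\<close>

lemma finite_vecs: "finite I \<Longrightarrow> finite (vecs I)"
  unfolding vecs_def by (intro finite_PiE) auto

lemma restrict_in_vecs: "restrict f I \<in> vecs I"
  by (simp add: vecs_def restrict_PiE_iff)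

text \<open>Distributivity: choosing one summand for each edge is the same as choosing an
  extensional vector on \<open>arcs G\<close>.\<close>

lemma graph_product_expansion:
  fixes s t :: "'q::nontriv mod_ring" and g :: "'q mod_ring \<Rightarrow> complex"
  assumes "finite (arcs G)"
  shows "(\<Prod>e\<in>arcs G. \<Sum>b\<in>UNIV. Const (g b) * Var (tail G e) ^ rep (t - s * b) * Var (head G e) ^ rep b)
    = (\<Sum>b\<in>vecs (arcs G). Poly_Mapping.single
         (\<Sum>e\<in>arcs G. Poly_Mapping.single (tail G e) (rep (t - s * b e)) +
                      Poly_Mapping.single (head G e) (rep (b e)))
         (\<Prod>e\<in>arcs G. g (b e)))"
  using assms
  by (simp add: prod_sum_PiE vecs_def Const_def Var_power mult_single prod_monomials)

text \<open>As \<open>of_nat\<close> undoes \<open>rep\<close>, the exponents can be added modulo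
  \<open>q\<close> edge by edge, tails and heads separately. A loop contributes to both sums at its
  vertex.\<close>

lemma residue_of_exponent:
  fixes s t :: "'q::nontriv mod_ring"
  assumes "finite (arcs G)" "v \<in> verts G"
  shows "of_nat (Poly_Mapping.lookup
      (\<Sum>e\<in>arcs G. Poly_Mapping.single (tail G e) (rep (t - s * b e)) +
                   Poly_Mapping.single (head G e) (rep (b e))) v)
    = T_tr G t (\<lambda>e\<in>arcs G. 1) v + S_tr G s b v"
proof -
  have "of_nat (Poly_Mapping.lookup
      (\<Sum>e\<in>arcs G. Poly_Mapping.single (tail G e) (rep (t - s * b e)) +
                   Poly_Mapping.single (head G e) (rep (b e))) v)
    = (\<Sum>e\<in>arcs G. if tail G e = v then t - s * b e else 0)
      + (\<Sum>e\<in>arcs G. if head G e = v then b e else 0)"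
    by (simp add: lookup_sum lookup_add lookup_single when_def of_nat_sum sum.distrib
        if_distrib[of of_nat] cong: if_cong)
  also have "\<dots> = (\<Sum>e | e \<in> arcs G \<and> tail G e = v. t - s * b e)
      + (\<Sum>e | e \<in> arcs G \<and> head G e = v. b e)"
    using assms(1) by (simp add: sum.inter_filter)
  also have "\<dots> = T_tr G t (\<lambda>e\<in>arcs G. 1) v + S_tr G s b v"
    using assms(2) by (simp add: T_tr_def S_tr_def sum_subtractf sum_distrib_left)
  finally show ?thesis .
qed

lemma coeff_at_graph_poly:
  fixes s t :: "'q::nontriv mod_ring" and g :: "'q mod_ring \<Rightarrow> complex"
  assumes "fin_digraph G"
  shows "coeff_at (verts G) a (graph_poly G s t g)
    = (\<Sum>b | b \<in> vecs (arcs G) \<and>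
         (\<forall>v\<in>verts G. S_tr G s b v = a v - T_tr G t (\<lambda>e\<in>arcs G. 1) v). \<Prod>e\<in>arcs G. g (b e))"
proof -
  interpret fin_digraph G by fact
  let ?m = "\<lambda>b. \<Sum>e\<in>arcs G. Poly_Mapping.single (tail G e) (rep (t - s * b e)) +
                Poly_Mapping.single (head G e) (rep (b e))"
  let ?p = "\<Sum>b\<in>vecs (arcs G). Poly_Mapping.single (?m b) (\<Prod>e\<in>arcs G. g (b e))"
  have "Poly_Mapping.keys (?m b) \<subseteq> verts G" for b
  proof
    fix x assume "x \<in> Poly_Mapping.keys (?m b)"
    then obtain e where "e \<in> arcs G" "x \<in> {tail G e, head G e}"
      using keys_sum[of "\<lambda>e. Poly_Mapping.single (tail G e) (rep (t - s * b e)) +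
                Poly_Mapping.single (head G e) (rep (b e))" "arcs G"] keys_add
      by (fastforce split: if_splits)
    then show "x \<in> verts G" by auto
  qed
  then have p: "?p \<in> polys (verts G)"
    by (intro polys_sum polys_single)
  have "coeff_at (verts G) a (graph_poly G s t g) = residue_coeff (verts G) a ?p"
    unfolding graph_poly_def graph_product_expansion[OF finite_arcs]
    by (rule coeff_at_poly_mod[OF finite_verts p])
  also have "\<dots> = (\<Sum>b\<in>vecs (arcs G). (\<Prod>e\<in>arcs G. g (b e)) *
      of_bool (\<forall>v\<in>verts G. S_tr G s b v = a v - T_tr G t (\<lambda>e\<in>arcs G. 1) v))"
    unfolding residue_coeff_def linear_extension_sum
    by (intro sum.cong refl) (simp add: residue_of_exponent eq_diff_eq add.commute[of "S_tr G s _ _"])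
  also have "\<dots> = (\<Sum>b | b \<in> vecs (arcs G) \<and>
         (\<forall>v\<in>verts G. S_tr G s b v = a v - T_tr G t (\<lambda>e\<in>arcs G. 1) v). \<Prod>e\<in>arcs G. g (b e))"
    using finite_vecs[OF finite_arcs]
    by (subst sum.inter_filter) (auto intro!: sum.cong)
  finally show ?thesis .
qed

section \<open>Cosets of the kernel\<close>

lemma ker_S_tr_iff:
  "b \<in> ker_S_tr G s \<longleftrightarrow> b \<in> vecs (arcs G) \<and> (\<forall>v\<in>verts G. S_tr G s b v = 0)"
  by (auto simp: ker_S_tr_def S_tr_def fun_eq_iff)

lemma S_tr_diff:
  "v \<in> verts G \<Longrightarrow> S_tr G s (\<lambda>e\<in>arcs G. b e - b' e) v = S_tr G s b v - S_tr G s b' v"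
  by (simp add: S_tr_def sum_subtractf algebra_simps)

lemma S_tr_add:
  "v \<in> verts G \<Longrightarrow> S_tr G s (\<lambda>e\<in>arcs G. b e + b' e) v = S_tr G s b v + S_tr G s b' v"
  by (simp add: S_tr_def sum.distrib algebra_simps)

text \<open>Two vectors have the same image under \<open>S_tr\<close> exactly when they differ by a
  kernel element. This identifies the index set in \<open>coeff_at_graph_poly\<close> with a
  coset.\<close>

lemma translate_ker_S_tr:
  assumes "b \<in> vecs (arcs G)"
  shows "translate (arcs G) (ker_S_tr G s) b
    = {b' \<in> vecs (arcs G). \<forall>v\<in>verts G. S_tr G s b' v = S_tr G s b v}"
proof (intro equalityI subsetI)
  fix b' assume "b' \<in> translate (arcs G) (ker_S_tr G s) b"
  then show "b' \<in> {b' \<in> vecs (arcs G). \<forall>v\<in>verts G. S_tr G s b' v = S_tr G s b v}"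
    by (auto simp: translate_def ker_S_tr_iff S_tr_add vecs_def)
next
  fix b' assume b': "b' \<in> {b' \<in> vecs (arcs G). \<forall>v\<in>verts G. S_tr G s b' v = S_tr G s b v}"
  then have "b' = (\<lambda>e\<in>arcs G. (\<lambda>e\<in>arcs G. b' e - b e) e + b e)"
    by (auto simp: vecs_def fun_eq_iff PiE_def extensional_def)
  moreover have "(\<lambda>e\<in>arcs G. b' e - b e) \<in> ker_S_tr G s"
    using b' by (auto simp: ker_S_tr_iff S_tr_diff vecs_def)
  ultimately show "b' \<in> translate (arcs G) (ker_S_tr G s) b"
    unfolding translate_def by blast
qed

section \<open>Weight enumerators and the MacWilliams transform\<close>

text \<open>Grouping the edges by the value \<open>p e\<close> collects the product over edges into
  powers, one for each symbol.\<close>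

lemma mpoly_eval_cwe:
  assumes "finite E"
  shows "mpoly_eval y (cwe E P) = (\<Sum>p\<in>P. \<Prod>e\<in>E. y (p e))"
proof -
  have "mpoly_eval y (\<Prod>a\<in>UNIV. Var a ^ card {e \<in> E. p e = a}) = (\<Prod>e\<in>E. y (p e))" for p
  proof -
    let ?m = "\<Sum>a\<in>UNIV. Poly_Mapping.single a (card {e \<in> E. p e = a})"
    have "mpoly_eval y (\<Prod>a\<in>UNIV. Var a ^ card {e \<in> E. p e = a})
        = (\<Prod>a\<in>Poly_Mapping.keys ?m. y a ^ Poly_Mapping.lookup ?m a)"
      by (simp add: mpoly_eval_eq_linear_extension Var_power prod_monomials)
    \<comment> \<open>Symbols that do not occur have exponent 0 and give the factor 1, even where
      \<open>y a\<close> is 0.\<close>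
    also have "\<dots> = (\<Prod>a\<in>UNIV. y a ^ Poly_Mapping.lookup ?m a)"
      by (intro prod.mono_neutral_left) (auto simp: in_keys_iff)
    also have "\<dots> = (\<Prod>a\<in>UNIV. \<Prod>e\<in>{e \<in> E. p e = a}. y (p e))"
      by (simp add: lookup_sum_single)
    also have "\<dots> = (\<Prod>e\<in>E. y (p e))"
      using assms by (intro prod.group) auto
    finally show ?thesis .
  qed
  then show ?thesis
    by (simp add: cwe_def mpoly_eval_eq_linear_extension linear_extension_sum)
qed

section \<open>The standard additive character modulo \<open>q\<close> and its orthogonality\<close>

definition additive_char :: "'q::nontriv mod_ring \<Rightarrow> complex" where
  "additive_char a = cis (2 * pi * real (rep a) / real CARD('q))"

text \<open>Removing a multiple of \<open>q\<close> from \<open>n\<close> changes the angle by full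
  turns, so any natural number representing a residue may be used.\<close>

lemma additive_char_of_nat:
  "additive_char (of_nat n :: 'q::nontriv mod_ring) = cis (2 * pi * real n / real CARD('q))"
proof -
  have "real n = real (n div CARD('q)) * real CARD('q) + real (n mod CARD('q))"
    by (simp flip: of_nat_mult of_nat_add)
  then have "2 * pi * real n / real CARD('q)
      = 2 * pi * real (n mod CARD('q)) / real CARD('q) + 2 * pi * real (n div CARD('q))"
    by (simp add: field_simps)
  then show ?thesis
    by (simp add: additive_char_def rep_of_nat flip: cis_mult)
qed

lemma additive_char_0 [simp]: "additive_char 0 = 1"
  using additive_char_of_nat[of 0] by simp

lemma additive_char_add: "additive_char (a + b) = additive_char a * additive_char b"
  for a b :: "'q::nontriv mod_ring"
proof -
  have "additive_char (a + b) = additive_char (of_nat (rep a + rep b) :: 'q mod_ring)"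
    by simp
  then show ?thesis
    unfolding additive_char_of_nat
    by (simp add: additive_char_def cis_mult add_divide_distrib distrib_left)
qed

lemma additive_char_mult:
  "additive_char (a * b) = cis (2 * pi * real (rep a * rep b) / real CARD('q))"
  for a b :: "'q::nontriv mod_ring"
  using additive_char_of_nat[of "rep a * rep b", where 'q = 'q] by simp

lemma additive_char_sum: "additive_char (\<Sum>i\<in>I. f i) = (\<Prod>i\<in>I. additive_char (f i))"
  by (induction I rule: infinite_finite_induct) (auto simp: additive_char_add)

text \<open>Value 1 forces \<open>q\<close> to divide \<open>rep a\<close>, which is below
  \<open>q\<close>. This faithfulness makes orthogonality work for composite \<open>q\<close>
  too.\<close>

lemma additive_char_eq_1_iff: "additive_char a = 1 \<longleftrightarrow> a = 0"
  for a :: "'q::nontriv mod_ring"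
proof
  assume "additive_char a = 1"
  then obtain n :: int where "2 * pi * real (rep a) / real CARD('q) = of_int n * (2 * pi)"
    unfolding additive_char_def cis_eq_1_iff by blast
  then have "real (rep a) = of_int n * real CARD('q)"
    by (simp add: field_simps)
  then have "int (rep a) = n * int CARD('q)"
    by (metis of_int_eq_iff of_int_mult of_int_of_nat_eq)
  then have "int CARD('q) dvd int (rep a)"
    by simp
  then have "rep a = 0"
    using rep_less[of a] by (metis dvd_imp_le int_dvd_int_iff linorder_not_le neq0_conv)
  then show "a = 0"
    using of_nat_rep[of a] by simp
qed simp

text \<open>For \<open>b\<close> in the kernel, adjointness makes every pairing 0 and every term 1.
  Otherwise some element of the image pairs nontrivially with \<open>b\<close>, and translating the
  sum by it multiplies the sum by a number other than 1.\<close>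

lemma sum_additive_char_im_S:
  fixes s :: "'q::nontriv mod_ring"
  assumes "fin_digraph G" "b \<in> vecs (arcs G)"
  shows "(\<Sum>p\<in>im_S G s. additive_char (\<Sum>e\<in>arcs G. p e * b e))
    = of_nat (card (im_S G s)) * of_bool (b \<in> ker_S_tr G s)"
proof (cases "b \<in> ker_S_tr G s")
  case True
  then have "(\<Sum>e\<in>arcs G. p e * b e) = 0" if "p \<in> im_S G s" for p
    using that by (auto simp: im_S_def S_tr_adjoint[OF assms(1)] ker_S_tr_iff)
  with True show ?thesis by simp
next
  case False
  interpret fin_digraph G by (rule assms(1))
  from False assms(2) obtain v where v: "v \<in> verts G" "S_tr G s b v \<noteq> 0"
    by (auto simp: ker_S_tr_iff)
  \<comment> \<open>The unit vector at \<open>v\<close>: by adjointness \<open>S_map G s d\<close>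
    pairs with \<open>b\<close> to \<open>S_tr G s b v\<close>, which is nonzero.\<close>
  define d where "d = (\<lambda>u. if u = v then 1 else 0 :: 'q mod_ring)"
  define c where "c = additive_char (S_tr G s b v)"
  let ?f = "\<lambda>p. additive_char (\<Sum>e\<in>arcs G. p e * b e)"
  \<comment> \<open>Since \<open>d\<close> need not be extensional, the preimages are restricted to
    \<open>verts G\<close> to land in \<open>vecs\<close>.\<close>
  have shift: "(\<lambda>e\<in>arcs G. S_map G s d' e + S_map G s d e) = S_map G s (\<lambda>u\<in>verts G. d' u + d u)"
    and unshift: "(\<lambda>e\<in>arcs G. S_map G s d' e - S_map G s d e) = S_map G s (\<lambda>u\<in>verts G. d' u - d u)"
    for d' by (auto simp: S_map_def fun_eq_iff algebra_simps)
  have "(\<Sum>p\<in>im_S G s. ?f p) = (\<Sum>p\<in>im_S G s. ?f (\<lambda>e\<in>arcs G. p e + S_map G s d e))"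
  proof (rule sum.reindex_bij_witness[where
        i = "\<lambda>p. \<lambda>e\<in>arcs G. p e + S_map G s d e" and j = "\<lambda>p. \<lambda>e\<in>arcs G. p e - S_map G s d e"])
    fix p assume "p \<in> im_S G s"
    then obtain d' where d': "p = S_map G s d'"
      by (auto simp: im_S_def)
    then show eq: "(\<lambda>e\<in>arcs G. (\<lambda>e\<in>arcs G. p e - S_map G s d e) e + S_map G s d e) = p"
      by (auto simp: S_map_def fun_eq_iff)
    show "(\<lambda>e\<in>arcs G. (\<lambda>e\<in>arcs G. p e + S_map G s d e) e - S_map G s d e) = p"
      using d' by (auto simp: S_map_def fun_eq_iff)
    show "(\<lambda>e\<in>arcs G. p e - S_map G s d e) \<in> im_S G s"
      unfolding d' unshift im_S_def by (intro imageI restrict_in_vecs)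
    show "(\<lambda>e\<in>arcs G. p e + S_map G s d e) \<in> im_S G s"
      unfolding d' shift im_S_def by (intro imageI restrict_in_vecs)
    show "?f (\<lambda>e\<in>arcs G. (\<lambda>e\<in>arcs G. p e - S_map G s d e) e + S_map G s d e) = ?f p"
      unfolding eq ..
  qed
  also have "\<dots> = (\<Sum>p\<in>im_S G s. c * ?f p)"
  proof (rule sum.cong[OF refl])
    fix p
    have "(\<Sum>e\<in>arcs G. (\<lambda>e\<in>arcs G. p e + S_map G s d e) e * b e)
        = (\<Sum>e\<in>arcs G. S_map G s d e * b e) + (\<Sum>e\<in>arcs G. p e * b e)"
      by (simp add: distrib_right sum.distrib)
    also have "(\<Sum>e\<in>arcs G. S_map G s d e * b e) = S_tr G s b v"
      using v unfolding S_tr_adjoint[OF assms(1)]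
      by (simp add: d_def if_distrib[of "\<lambda>x. x * _"] cong: if_cong)
    finally show "?f (\<lambda>e\<in>arcs G. p e + S_map G s d e) = c * ?f p"
      by (simp add: additive_char_add c_def)
  qed
  \<comment> \<open>The sum equals \<open>c\<close> times itself.\<close>
  finally have "(1 - c) * (\<Sum>p\<in>im_S G s. ?f p) = 0"
    by (simp only: left_diff_distrib mult_1 sum_distrib_left [symmetric] diff_self)
  moreover have "c \<noteq> 1"
    using v by (simp add: c_def additive_char_eq_1_iff)
  ultimately show ?thesis
    using False by simp
qed

text \<open>Expanding the product of transforms gives a double sum over the image and all edge
  vectors \<open>b\<close>; after exchanging the sums, orthogonality keeps only the \<open>b\<close>
  in the kernel.\<close>

lemma macwilliams_im_S:
  assumes "fin_digraph G"
  shows "(\<Sum>p\<in>im_S G s. \<Prod>e\<in>arcs G. fourier g (p e))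
    = of_nat (card (im_S G s)) * (\<Sum>b\<in>ker_S_tr G s. \<Prod>e\<in>arcs G. g (b e))"
proof -
  interpret fin_digraph G by fact
  have "(\<Sum>p\<in>im_S G s. \<Prod>e\<in>arcs G. fourier g (p e))
    = (\<Sum>p\<in>im_S G s. \<Sum>b\<in>vecs (arcs G).
        (\<Prod>e\<in>arcs G. g (b e)) * additive_char (\<Sum>e\<in>arcs G. p e * b e))"
    by (simp add: fourier_def prod_sum_PiE vecs_def additive_char_sum additive_char_mult prod.distrib)
  also have "\<dots> = (\<Sum>b\<in>vecs (arcs G). (\<Prod>e\<in>arcs G. g (b e)) *
      (\<Sum>p\<in>im_S G s. additive_char (\<Sum>e\<in>arcs G. p e * b e)))"
    by (subst sum.swap) (simp add: sum_distrib_left)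
  also have "\<dots> = (\<Sum>b\<in>vecs (arcs G). of_nat (card (im_S G s)) *
      (if b \<in> ker_S_tr G s then \<Prod>e\<in>arcs G. g (b e) else 0))"
    by (intro sum.cong refl) (simp add: sum_additive_char_im_S[OF assms])
  also have "\<dots> = of_nat (card (im_S G s)) *
      (\<Sum>b\<in>{b \<in> vecs (arcs G). b \<in> ker_S_tr G s}. \<Prod>e\<in>arcs G. g (b e))"
    using finite_vecs[OF finite_arcs]
    by (subst sum.inter_filter) (simp_all add: sum_distrib_left)
  also have "{b \<in> vecs (arcs G). b \<in> ker_S_tr G s} = ker_S_tr G s"
    by (auto simp: ker_S_tr_iff)
  finally show ?thesis .
qed

lemma card_im_S_pos:
  assumes "fin_digraph G"
  shows "card (im_S G s) > 0"
proof -
  interpret fin_digraph G by fact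
  show ?thesis
    using finite_vecs[OF finite_verts] restrict_in_vecs[of _ "verts G"] by (auto simp: im_S_def card_gt_0_iff)
qed

theorem theorem5:
  fixes G :: "('v, 'e) pre_digraph"
    and s t :: "'q::nontriv mod_ring"
    and g :: "'q mod_ring \<Rightarrow> complex"
  assumes "fin_digraph G"
  shows
    "(\<forall>a\<in>vecs (verts G). \<forall>b\<in>vecs (arcs G).
        S_tr G s b = (\<lambda>v\<in>verts G. a v - T_tr G t (\<lambda>e\<in>arcs G. 1) v) \<longrightarrow>
          coeff_at (verts G) a (graph_poly G s t g)
            = (\<Sum>b'\<in>translate (arcs G) (ker_S_tr G s) b. \<Prod>e\<in>arcs G. g (b' e)) \<and>
          coeff_at (verts G) a (graph_poly G s t g)
            = mpoly_eval g (cwe (arcs G) (translate (arcs G) (ker_S_tr G s) b))) \<and>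
     coeff_at (verts G) (T_tr G t (\<lambda>e\<in>arcs G. 1)) (graph_poly G s t g)
       = (\<Sum>b'\<in>ker_S_tr G s. \<Prod>e\<in>arcs G. g (b' e)) \<and>
     coeff_at (verts G) (T_tr G t (\<lambda>e\<in>arcs G. 1)) (graph_poly G s t g)
       = mpoly_eval g (cwe (arcs G) (ker_S_tr G s)) \<and>
     (\<exists>c. c ^ card (arcs G) * of_nat (card (im_S G s)) = 1 \<and>
          coeff_at (verts G) (T_tr G t (\<lambda>e\<in>arcs G. 1)) (graph_poly G s t g)
            = mpoly_eval (\<lambda>a. c * fourier g a) (cwe (arcs G) (im_S G s)))"
proof -
  interpret fin_digraph G by fact
  let ?coeff = "\<lambda>a. coeff_at (verts G) a (graph_poly G s t g)"
  let ?T1 = "T_tr G t (\<lambda>e\<in>arcs G. 1)"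
  have coset: "?coeff a = (\<Sum>b'\<in>translate (arcs G) (ker_S_tr G s) b. \<Prod>e\<in>arcs G. g (b' e))"
    if "b \<in> vecs (arcs G)" "S_tr G s b = (\<lambda>v\<in>verts G. a v - ?T1 v)" for a b
    using that by (simp add: coeff_at_graph_poly[OF assms] translate_ker_S_tr)
  have ker: "?coeff ?T1 = (\<Sum>b'\<in>ker_S_tr G s. \<Prod>e\<in>arcs G. g (b' e))"
    \<comment> \<open>At this exponent the right-hand side of the linear system is 0.\<close>
    by (simp add: coeff_at_graph_poly[OF assms] flip: ker_S_tr_iff)
  have "\<exists>c :: complex. c ^ card (arcs G) * of_nat (card (im_S G s)) = 1"
  proof (cases "arcs G = {}")
    \<comment> \<open>Without edges \<open>c ^ 0\<close> is 1 for every \<open>c\<close>; the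
      equation holds because the image consists of the empty vector alone.\<close>
    case True
    then have "im_S G s \<subseteq> {\<lambda>_. undefined}"
      by (auto simp: im_S_def S_map_def)
    then have "im_S G s = {\<lambda>_. undefined}"
      using card_im_S_pos[OF assms, of s] by (auto simp: subset_singleton_iff)
    with True show ?thesis by simp
  next
    case False
    then have "card (arcs G) > 0"
      by (simp add: card_gt_0_iff)
    \<comment> \<open>A real root of the reciprocal spreads the factor evenly over the
      edges.\<close>
    then have "complex_of_real (root (card (arcs G)) (1 / card (im_S G s))) ^ card (arcs G)
        * of_nat (card (im_S G s)) = 1"
      using card_im_S_pos[OF assms, of s] by (simp flip: of_real_power)
    then show ?thesis ..
  qed
  then obtain c :: complex where c: "c ^ card (arcs G) * of_nat (card (im_S G s)) = 1" ..
  \<comment> \<open>Each edge contributes one factor \<open>c\<close>, so the power cancels the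
    cardinality from \<open>macwilliams_im_S\<close>.\<close>
  have "mpoly_eval (\<lambda>a. c * fourier g a) (cwe (arcs G) (im_S G s))
      = c ^ card (arcs G) * (\<Sum>p\<in>im_S G s. \<Prod>e\<in>arcs G. fourier g (p e))"
    by (simp add: mpoly_eval_cwe prod.distrib sum_distrib_left)
  also have "\<dots> = ?coeff ?T1"
    using c by (simp add: macwilliams_im_S[OF assms] ker flip: mult.assoc)
  finally show ?thesis
    using c coset ker by (auto simp: mpoly_eval_cwe)
qed

end
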